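(* Let $Y_1,Y_2,\dots$ be i.i.d. with the folded normal density $f(\cdot;0,\sigma_0)$, where $\sigma_0>0$ is known and fixed (so the true mean parameter is $\mu_0=0$). Let $\hat\mu_n^{(\sigma_0)}\in\arg\max_{\mu\in\mathbb{R}}\ell_n(\mu,\sigma_0)$ be any measurable maximizer selection, where $\ell_n(\mu,\sigma_0)=\sum_{i=1}^n\log f(Y_i;\mu,\sigma_0)$, and let $\bar\mu_n^{(\sigma_0)}:=|\hat\mu_n^{(\sigma_0)}|$. Then, as $n\to\infty$, $$n^{1/4}\,\bar\mu_n^{(\sigma_0)}\ \xrightarrow{d}\ \sqrt{Z_+}=2^{1/4}\sigma_0\sqrt{W_+},$$ where $W\sim N(0,1)$ and $Z=\sqrt2\,\sigma_0^2W\sim N(0,2\sigma_0^4)$. Equivalently, the limit law of $n^{1/4}\bar\mu_n^{(\sigma_0)}$ has an atom at $0$ of mass $1/2$, and conditional on $W>0$ the limit variable equals $2^{1/4}\sigma_0\sqrt W$.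
   Context: The folded normal density with parameters $\mu\in\mathbb{R}$, $\sigma>0$ is $f(y;\mu,\sigma)=\frac1\sigma\{\varphi(\frac{y-\mu}{\sigma})+\varphi(\frac{y+\mu}{\sigma})\}$ for $y\ge0$, with $\varphi(z)=(2\pi)^{-1/2}e^{-z^2/2}$. $x_+=\max(x,0)$, and $\xrightarrow{d}$ denotes convergence in distribution. *)

theory Defs
  imports "HOL-Probability.Probability"
begin

text \<open>Density with respect to Lebesgue measure on the whole real line, extended by \<open>0\<close> to \<open>y < 0\<close>.\<close>

definition folded_normal_density :: "real \<Rightarrow> real \<Rightarrow> real \<Rightarrow> real" where
  "folded_normal_density \<mu> \<sigma> y =
     (if y \<ge> 0
      then 1 / \<sigma> * (std_normal_density ((y - \<mu>) / \<sigma>) + std_normal_density ((y + \<mu>) / \<sigma>))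
      else 0)"

text \<open>
  The sample \<open>y\<^sub>1, \<dots>, y\<^sub>n\<close> is indexed from \<open>0\<close> here. The convention \<open>ln 0 = 0\<close> only matters
  for negative observations, which have probability \<open>0\<close> under every folded normal law.
\<close>

definition folded_normal_loglik :: "(nat \<Rightarrow> real) \<Rightarrow> nat \<Rightarrow> real \<Rightarrow> real \<Rightarrow> real" where
  "folded_normal_loglik y n \<mu> \<sigma> = (\<Sum>i<n. ln (folded_normal_density \<mu> \<sigma> (y i)))"

end

theory Submission
  imports Defs "HOL-Real_Asymp.Real_Asymp"
begin

text \<open>
  After rescaling by \<open>\<sigma>\<^sub>0\<close>, the log-likelihood is, up to a constant, \<open>\<Sum>i<n. ln (cosh (x\<^sub>i t)) - t\<^sup>2 / 2\<close>.
  It is concave as a function of \<open>t\<^sup>2\<close>, because \<open>tanh u / u\<close> is decreasing. Hence the event that a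
  maximizer has modulus at most \<open>s\<close> is, up to ties, the event that the derivative at \<open>s\<close> is
  not positive, i.e. \<open>\<Sum>i<n. x\<^sub>i tanh (x\<^sub>i s) / s - 1 \<le> 0\<close>. For \<open>s = a n\<^sup>-\<^sup>1\<^sup>/\<^sup>4\<close>, the expansion
  \<open>x tanh (x s) / s = x\<^sup>2 - s\<^sup>2 x\<^sup>4 / 3 + O(s\<^sup>4 x\<^sup>6)\<close> and the law of large numbers turn this sum divided by
  \<open>sqrt n\<close> into \<open>\<Sum>i<n. (x\<^sub>i\<^sup>2 - 1) / sqrt n - a\<^sup>2 + o(1)\<close> in probability, and the central limit theorem
  gives the limit \<open>P (sqrt 2 W \<le> a\<^sup>2)\<close>.
\<close>

section \<open>Taylor bounds and monotonicity for the hyperbolic tangent\<close>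

lemma tanh_le_self:
  fixes u :: real
  assumes "u \<ge> 0"
  shows "tanh u \<le> u"
proof -
  have "(\<lambda>u. u - tanh u) 0 \<le> (\<lambda>u. u - tanh u) u"
    by (rule DERIV_nonneg_imp_nondecreasing[OF assms])
       (intro exI conjI, (rule derivative_eq_intros refl | simp)+)
  then show ?thesis by simp
qed

text \<open>Since \<open>tanh\<close> has derivative \<open>1 - (tanh x)\<^sup>2\<close>, each
  Taylor bound follows by integrating the square of the preceding one. Here the difference has
  derivative \<open>x\<^sup>2 - (tanh x)\<^sup>2\<close>, which is nonnegative by the linear
  bound.\<close>

lemma tanh_ge_cubic:
  fixes u :: real
  assumes "u \<ge> 0"
  shows "u - u ^ 3 / 3 \<le> tanh u"
proof -
  have "(\<lambda>u. tanh u - u + u ^ 3 / 3) 0 \<le> (\<lambda>u. tanh u - u + u ^ 3 / 3) u"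
  proof (rule DERIV_nonneg_imp_nondecreasing[OF assms])
    fix x :: real assume "0 \<le> x"
    then have "(tanh x)\<^sup>2 \<le> x\<^sup>2"
      by (intro power_mono tanh_le_self) auto
    then show "\<exists>y. ((\<lambda>u. tanh u - u + u ^ 3 / 3) has_real_derivative y) (at x) \<and> 0 \<le> y"
      by (intro exI[of _ "1 - (tanh x)\<^sup>2 - 1 + x\<^sup>2"] conjI) (auto intro!: derivative_eq_intros)
  qed
  then show ?thesis by simp
qed

text \<open>The next step of the same scheme: squaring the cubic lower bound gives
  \<open>x\<^sup>2 - 2 * x ^ 4 / 3 \<le> (tanh x)\<^sup>2\<close>, and integration produces the
  coefficient 2/15.\<close>

lemma tanh_le_quintic:
  fixes u :: real
  assumes "u \<ge> 0"
  shows "tanh u \<le> u - u ^ 3 / 3 + 2 * u ^ 5 / 15"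
proof -
  have "(\<lambda>u. u - u ^ 3 / 3 + 2 * u ^ 5 / 15 - tanh u) 0 \<le> (\<lambda>u. u - u ^ 3 / 3 + 2 * u ^ 5 / 15 - tanh u) u"
  proof (rule DERIV_nonneg_imp_nondecreasing[OF assms])
    fix x :: real assume x: "0 \<le> x"
    have "x\<^sup>2 - 2 * x ^ 4 / 3 \<le> (tanh x)\<^sup>2"
    \<comment> \<open>The cubic bound may be squared only where it is nonnegative. Elsewhere the
      left-hand side is already nonpositive.\<close>
    proof (cases "x - x ^ 3 / 3 \<ge> 0")
      case True
      have "x\<^sup>2 - 2 * x ^ 4 / 3 \<le> x\<^sup>2 - 2 * x ^ 4 / 3 + (x ^ 3)\<^sup>2 / 9"
        by simp
      also have "\<dots> = (x - x ^ 3 / 3)\<^sup>2"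
        by (simp add: power2_eq_square power3_eq_cube power4_eq_xxxx field_simps)
      also have "\<dots> \<le> (tanh x)\<^sup>2"
        using True tanh_ge_cubic[OF x] by (intro power_mono)
      finally show ?thesis .
    next
      case False
      have "x\<^sup>2 - 2 * x ^ 4 / 3 = x * (x - x ^ 3 / 3) - x ^ 4 / 3"
        by (simp add: power2_eq_square power3_eq_cube power4_eq_xxxx field_simps)
      also have "\<dots> \<le> 0"
        using False x mult_nonneg_nonpos[of x "x - x ^ 3 / 3"] zero_le_power[OF x, of 4] by linarith
      finally show ?thesis
        using zero_le_power2[of "tanh x"] by linarith
    qed
    then show "\<exists>y. ((\<lambda>u. u - u ^ 3 / 3 + 2 * u ^ 5 / 15 - tanh u) has_real_derivative y) (at x) \<and> 0 \<le> y"
      by (intro exI[of _ "1 - x\<^sup>2 + 2 * x ^ 4 / 3 - (1 - (tanh x)\<^sup>2)"] conjI)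
         (auto intro!: derivative_eq_intros)
  qed
  then show ?thesis by simp
qed

text \<open>This is the monotonicity of \<open>tanh u / u\<close> with denominators cleared, so that
  \<open>u = 0\<close> is covered as well.\<close>

lemma tanh_quotient_antimono:
  fixes u v :: real
  assumes "0 \<le> u" "u \<le> v"
  shows "u * tanh v \<le> v * tanh u"
proof -
  \<comment> \<open>For positive \<open>x\<close> this says that the derivative of
    \<open>tanh x / x\<close> is not positive.\<close>
  have slope: "x * (1 - (tanh x)\<^sup>2) \<le> tanh x" if "0 \<le> x" for x :: real
  proof -
    have "(\<lambda>x. tanh x - x * (1 - (tanh x)\<^sup>2)) 0 \<le> (\<lambda>x. tanh x - x * (1 - (tanh x)\<^sup>2)) x"
    proof (rule DERIV_nonneg_imp_nondecreasing[OF that])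
      fix y :: real assume y: "0 \<le> y"
      have "(tanh y)\<^sup>2 \<le> 1"
        using tanh_real_bounds[of y] by (auto simp: abs_square_le_1 abs_le_iff)
      then have "0 \<le> 2 * y * tanh y * (1 - (tanh y)\<^sup>2)"
        using y by simp
      then show "\<exists>z. ((\<lambda>x. tanh x - x * (1 - (tanh x)\<^sup>2)) has_real_derivative z) (at y) \<and> 0 \<le> z"
        by (intro exI[of _ "2 * y * tanh y * (1 - (tanh y)\<^sup>2)"] conjI)
           (auto intro!: derivative_eq_intros simp: algebra_simps)
    qed
    then show ?thesis by simp
  qed
  have "(\<lambda>v. v * tanh u - u * tanh v) u \<le> (\<lambda>v. v * tanh u - u * tanh v) v"
  proof (rule DERIV_nonneg_imp_nondecreasing[OF assms(2)])
    fix y assume y: "u \<le> y"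
    have "(tanh u)\<^sup>2 \<le> (tanh y)\<^sup>2"
      using y assms by (intro power_mono) auto
    then have "u * (1 - (tanh y)\<^sup>2) \<le> u * (1 - (tanh u)\<^sup>2)"
      using assms by (intro mult_left_mono) auto
    also have "\<dots> \<le> tanh u"
      using slope assms by simp
    finally show "\<exists>z. ((\<lambda>v. v * tanh u - u * tanh v) has_real_derivative z) (at y) \<and> 0 \<le> z"
      by (intro exI[of _ "tanh u - u * (1 - (tanh y)\<^sup>2)"] conjI)
         (auto intro!: derivative_eq_intros)
  qed
  then show ?thesis by simp
qed

text \<open>Concavity in \<open>t\<^sup>2\<close>, stated as a tangent-line bound at \<open>s\<^sup>2\<close>.\<close>

lemma ln_cosh_tangent_in_square:
  fixes x s t :: real
  assumes "0 \<le> x" "0 < s" "0 \<le> t"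
  shows "ln (cosh (x * t)) \<le> ln (cosh (x * s)) + x * tanh (x * s) / s * (t\<^sup>2 - s\<^sup>2) / 2"
proof -
  \<comment> \<open>\<open>F\<close> is the tangent line in the variable \<open>t\<^sup>2\<close>
    minus the function. It vanishes at \<open>s\<close>. For positive \<open>x\<close> and
    \<open>y\<close> its derivative at \<open>y\<close> has the sign of
    \<open>tanh (x * s) / (x * s) - tanh (x * y) / (x * y)\<close>, so \<open>F\<close> falls before
    \<open>s\<close> and rises after it.\<close>
  define F where "F t = x * tanh (x * s) / s * (t\<^sup>2 - s\<^sup>2) / 2 + ln (cosh (x * s)) - ln (cosh (x * t))" for t
  have F': "(F has_real_derivative x * (tanh (x * s) * y / s - tanh (x * y))) (at y)" for y
    unfolding F_def using assms by (auto intro!: derivative_eq_intros simp: tanh_def field_simps)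
  have "0 \<le> F t"
  proof (cases "s \<le> t")
    case True
    have "F s \<le> F t"
    proof (rule DERIV_nonneg_imp_nondecreasing[OF True])
      fix y assume y: "s \<le> y"
      have "x * s * tanh (x * y) \<le> x * y * tanh (x * s)"
        using assms y by (intro tanh_quotient_antimono mult_left_mono) auto
      then have "0 \<le> x * (tanh (x * s) * y / s - tanh (x * y))"
        using assms by (simp add: field_simps)
      with F' show "\<exists>z. (F has_real_derivative z) (at y) \<and> 0 \<le> z" by blast
    qed
    then show ?thesis by (simp add: F_def)
  next
    case False
    then have "t \<le> s" by simp
    have "F s \<le> F t"
    proof (rule DERIV_nonpos_imp_nonincreasing[OF \<open>t \<le> s\<close>])
      fix y assume y: "t \<le> y" "y \<le> s"
      have "x * y * tanh (x * s) \<le> x * s * tanh (x * y)"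
        using assms y by (intro tanh_quotient_antimono mult_left_mono) auto
      then have "x * (tanh (x * s) * y / s - tanh (x * y)) \<le> 0"
        using assms by (simp add: field_simps)
      with F' show "\<exists>z. (F has_real_derivative z) (at y) \<and> z \<le> 0" by blast
    qed
    then show ?thesis by (simp add: F_def)
  qed
  then show ?thesis by (simp add: F_def)
qed

section \<open>The rescaled log-likelihood, its slope in the squared parameter, and its
  maximizers\<close>

definition ln_cosh_loglik :: "(nat \<Rightarrow> real) \<Rightarrow> nat \<Rightarrow> real \<Rightarrow> real" where
  "ln_cosh_loglik x n t = (\<Sum>i<n. ln (cosh (x i * t)) - t\<^sup>2 / 2)"

text \<open>For \<open>s > 0\<close> this is the derivative of \<open>ln_cosh_loglik\<close> divided
  by \<open>s\<close>, that is, twice its derivative with respect to \<open>s\<^sup>2\<close>. The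
  division removes the critical point at 0 that evenness forces.\<close>

definition score_ratio :: "(nat \<Rightarrow> real) \<Rightarrow> nat \<Rightarrow> real \<Rightarrow> real" where
  "score_ratio x n s = (\<Sum>i<n. x i * tanh (x i * s) / s - 1)"

text \<open>The tangent bounds are summed. The term \<open>t\<^sup>2 / 2\<close> is linear in
  \<open>t\<^sup>2\<close>, so it only lowers the slope of each summand.\<close>

lemma ln_cosh_loglik_tangent:
  assumes "\<And>i. i < n \<Longrightarrow> 0 \<le> x i" "0 < s" "0 \<le> t"
  shows "ln_cosh_loglik x n t \<le> ln_cosh_loglik x n s + score_ratio x n s * (t\<^sup>2 - s\<^sup>2) / 2"
proof -
  have "ln_cosh_loglik x n t \<le>
      (\<Sum>i<n. (ln (cosh (x i * s)) - s\<^sup>2 / 2) + (x i * tanh (x i * s) / s - 1) * (t\<^sup>2 - s\<^sup>2) / 2)"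
    unfolding ln_cosh_loglik_def
  proof (rule sum_mono)
    fix i assume "i \<in> {..<n}"
    then show "ln (cosh (x i * t)) - t\<^sup>2 / 2 \<le>
        (ln (cosh (x i * s)) - s\<^sup>2 / 2) + (x i * tanh (x i * s) / s - 1) * (t\<^sup>2 - s\<^sup>2) / 2"
      using ln_cosh_tangent_in_square[of "x i" s t] assms
      by (simp add: left_diff_distrib diff_divide_distrib)
  qed
  also have "\<dots> = ln_cosh_loglik x n s + score_ratio x n s * (t\<^sup>2 - s\<^sup>2) / 2"
    by (simp add: ln_cosh_loglik_def score_ratio_def sum.distrib sum_distrib_right sum_divide_distrib)
  finally show ?thesis .
qed

lemma ln_cosh_loglik_abs: "ln_cosh_loglik x n \<bar>t\<bar> = ln_cosh_loglik x n t"
  by (auto simp: ln_cosh_loglik_def abs_if)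

lemma ln_cosh_loglik_deriv:
  assumes "s \<noteq> 0"
  shows "(ln_cosh_loglik x n has_real_derivative s * score_ratio x n s) (at s)"
  unfolding ln_cosh_loglik_def[abs_def] using assms
  by (auto intro!: derivative_eq_intros sum.cong
      simp: score_ratio_def tanh_def field_simps sum_distrib_left)

text \<open>By concavity in the squared parameter, a negative slope at \<open>s\<close> makes every
  point beyond \<open>s\<close> strictly worse than \<open>s\<close>.\<close>

lemma argmax_le_of_score_neg:
  assumes x: "\<And>i. i < n \<Longrightarrow> 0 \<le> x i" and s: "0 < s"
    and max: "\<And>u. ln_cosh_loglik x n u \<le> ln_cosh_loglik x n t"
    and neg: "score_ratio x n s < 0"
  shows "\<bar>t\<bar> \<le> s"
proof (rule ccontr)
  assume "\<not> \<bar>t\<bar> \<le> s"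
  then have "s\<^sup>2 < \<bar>t\<bar>\<^sup>2"
    using s by (intro power_strict_mono) auto
  then have "score_ratio x n s * (\<bar>t\<bar>\<^sup>2 - s\<^sup>2) / 2 < 0"
    using neg by (simp add: mult_less_0_iff)
  with ln_cosh_loglik_tangent[where t = "\<bar>t\<bar>" and x = x and n = n, OF x s] max[of s] show False
    by (simp add: ln_cosh_loglik_abs)
qed

text \<open>A partial converse: a positive slope at \<open>s\<close> makes every point of modulus
  below \<open>s\<close> strictly worse. Only the weak inequality holds, since the slope vanishes
  when the maximizer has modulus exactly \<open>s\<close>.\<close>

lemma score_nonpos_of_argmax_le:
  assumes x: "\<And>i. i < n \<Longrightarrow> 0 \<le> x i" and s: "0 < s"
    and max: "\<And>u. ln_cosh_loglik x n u \<le> ln_cosh_loglik x n t"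
    and le: "\<bar>t\<bar> \<le> s"
  shows "score_ratio x n s \<le> 0"
\<comment> \<open>At equality the tangent bound is vacuous, and the first-order condition at the
  maximum takes its place.\<close>
proof (cases "\<bar>t\<bar> = s")
  case True
  have "s * score_ratio x n s = 0"
  proof (rule DERIV_local_max[OF ln_cosh_loglik_deriv])
    show "\<forall>y. \<bar>s - y\<bar> < 1 \<longrightarrow> ln_cosh_loglik x n y \<le> ln_cosh_loglik x n s"
      using max ln_cosh_loglik_abs[of x n t] True by simp
  qed (use s in auto)
  then show ?thesis using s by simp
next
  case False
  show ?thesis
  proof (rule ccontr)
    assume pos: "\<not> score_ratio x n s \<le> 0"
    have "\<bar>t\<bar>\<^sup>2 < s\<^sup>2"
      using False le by (intro power_strict_mono) auto
    then have "score_ratio x n s * (\<bar>t\<bar>\<^sup>2 - s\<^sup>2) / 2 < 0"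
      using pos by (simp add: mult_less_0_iff)
    with ln_cosh_loglik_tangent[where t = "\<bar>t\<bar>" and x = x and n = n, OF x s] max[of s] show False
      by (simp add: ln_cosh_loglik_abs)
  qed
qed

text \<open>With \<open>a = y i / \<sigma>\<close> and \<open>b = \<mu> / \<sigma>\<close>, the two
  normal terms combine into the normal density at \<open>a\<close> times
  \<open>2 * cosh (a * b) * exp (- b\<^sup>2 / 2)\<close>. The first sum is free of
  \<open>\<mu>\<close>, so maximizers correspond under division by \<open>\<sigma>\<close>.\<close>

lemma folded_normal_loglik_eq:
  assumes "0 < \<sigma>" "\<And>i. i < n \<Longrightarrow> 0 \<le> y i"
  shows "folded_normal_loglik y n \<mu> \<sigma> =
    (\<Sum>i<n. ln (2 / \<sigma> * std_normal_density (y i / \<sigma>))) + ln_cosh_loglik (\<lambda>i. y i / \<sigma>) n (\<mu> / \<sigma>)"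
proof -
  have "ln (folded_normal_density \<mu> \<sigma> (y i)) = ln (2 / \<sigma> * std_normal_density (y i / \<sigma>)) +
      (ln (cosh (y i / \<sigma> * (\<mu> / \<sigma>))) - (\<mu> / \<sigma>)\<^sup>2 / 2)" if "i < n" for i
  proof -
    define a b where "a = y i / \<sigma>" and "b = \<mu> / \<sigma>"
    have "std_normal_density (a - b) + std_normal_density (a + b) =
        2 * std_normal_density a * (cosh (a * b) * exp (- b\<^sup>2 / 2))"
    proof -
      have "exp (- (a - b)\<^sup>2 / 2) = exp (- a\<^sup>2 / 2) * (exp (a * b) * exp (- b\<^sup>2 / 2))"
        and "exp (- (a + b)\<^sup>2 / 2) = exp (- a\<^sup>2 / 2) * (exp (- (a * b)) * exp (- b\<^sup>2 / 2))"
        by (auto simp: power2_eq_square field_simps simp flip: exp_add)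
      then show ?thesis
        by (simp add: std_normal_density_def cosh_def field_simps)
    qed
    then have "folded_normal_density \<mu> \<sigma> (y i) =
        (2 / \<sigma> * std_normal_density a) * (cosh (a * b) * exp (- b\<^sup>2 / 2))"
      using assms(2)[OF that]
      by (simp add: folded_normal_density_def a_def b_def diff_divide_distrib add_divide_distrib)
    moreover have "0 < 2 / \<sigma> * std_normal_density a"
      using assms by (simp add: normal_density_pos)
    ultimately have "ln (folded_normal_density \<mu> \<sigma> (y i)) =
        ln (2 / \<sigma> * std_normal_density a) + (ln (cosh (a * b)) + ln (exp (- b\<^sup>2 / 2)))"
      by (simp only: ln_mult_pos mult_pos_pos cosh_real_pos exp_gt_zero)
    then show ?thesis
      by (simp add: a_def b_def)
  qed
  then show ?thesis
    by (simp add: folded_normal_loglik_def ln_cosh_loglik_def sum.distrib)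
qed

text \<open>The cubic and quintic bounds at \<open>u = x i * s\<close>, multiplied by
  \<open>x i / s\<close>, with the constant 2/15 rounded up to 1.\<close>

lemma score_ratio_expansion:
  assumes "\<And>i. i < n \<Longrightarrow> 0 \<le> x i" "0 < s"
  shows "\<bar>score_ratio x n s - (\<Sum>i<n. (x i)\<^sup>2 - 1) + s\<^sup>2 / 3 * (\<Sum>i<n. x i ^ 4)\<bar> \<le> s ^ 4 * (\<Sum>i<n. x i ^ 6)"
proof -
  have "score_ratio x n s - (\<Sum>i<n. (x i)\<^sup>2 - 1) + s\<^sup>2 / 3 * (\<Sum>i<n. x i ^ 4) =
      (\<Sum>i<n. x i * tanh (x i * s) / s - (x i)\<^sup>2 + s\<^sup>2 / 3 * x i ^ 4)"
    by (simp add: score_ratio_def sum_distrib_left sum.distrib sum_subtractf)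
  also have "\<bar>\<dots>\<bar> \<le> (\<Sum>i<n. s ^ 4 * x i ^ 6)"
  proof (rule order_trans[OF sum_abs sum_mono])
    fix i assume "i \<in> {..<n}"
    then have xi: "0 \<le> x i" using assms by simp
    define u where "u = x i * s"
    have u: "0 \<le> u" using xi assms by (simp add: u_def)
    have "\<bar>tanh u - u + u ^ 3 / 3\<bar> \<le> u ^ 5"
      using tanh_ge_cubic[OF u] tanh_le_quintic[OF u] zero_le_power[OF u, of 5]
      by (simp add: abs_le_iff)
    then have "x i / s * \<bar>tanh u - u + u ^ 3 / 3\<bar> \<le> x i / s * u ^ 5"
      using xi assms by (intro mult_left_mono) auto
    also have "x i / s * \<bar>tanh u - u + u ^ 3 / 3\<bar> = \<bar>x i / s * (tanh u - u + u ^ 3 / 3)\<bar>"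
      using xi assms by (simp add: abs_mult)
    also have "x i / s * (tanh u - u + u ^ 3 / 3) = x i * tanh (x i * s) / s - (x i)\<^sup>2 + s\<^sup>2 / 3 * x i ^ 4"
      using assms by (simp add: u_def field_simps power2_eq_square power3_eq_cube power4_eq_xxxx)
    also have "x i / s * u ^ 5 = s ^ 4 * x i ^ 6"
      using assms by (simp add: u_def field_simps eval_nat_numeral)
    finally show "\<bar>x i * tanh (x i * s) / s - (x i)\<^sup>2 + s\<^sup>2 / 3 * x i ^ 4\<bar> \<le> s ^ 4 * x i ^ 6" .
  qed
  finally show ?thesis by (simp add: sum_distrib_left)
qed

section \<open>Even moments of the folded normal law with mean parameter 0\<close>

lemma has_bochner_integral_even_halfline:
  fixes f :: "real \<Rightarrow> real"
  assumes f: "has_bochner_integral lborel f I" and even: "\<And>x. f (- x) = f x"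
  shows "has_bochner_integral lborel (\<lambda>x. indicator {0..} x * f x) (I / 2)"
proof -
  have "integrable lborel (\<lambda>x. indicator {0..} x *\<^sub>R f x)"
    using f by (intro integrable_mult_indicator) (auto simp: has_bochner_integral_iff)
  then obtain J where J: "has_bochner_integral lborel (\<lambda>x. indicator {0..} x *\<^sub>R f x) J"
    by (auto simp: integrable.simps)
  \<comment> \<open>The rule for even functions leads from the half line to the whole line.
    Uniqueness of the integral turns it round.\<close>
  then have "I = 2 * J"
    using has_bochner_integral_even_function[OF J even] has_bochner_integral_eq[OF f] by auto
  with J show ?thesis by simp
qed

lemma folded_normal_density_zero_mean:
  "0 < \<sigma> \<Longrightarrow> folded_normal_density 0 \<sigma> y = 2 * (indicator {0..} y * normal_density 0 \<sigma> y)"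
  by (auto simp: folded_normal_density_def normal_density_def indicator_def field_simps real_sqrt_mult)

text \<open>Folding does not change even powers, so these are the even moments of a standard normal
  variable: 1, 3 and 15 for \<open>k\<close> equal to 1, 2 and 3.\<close>

lemma folded_normal_moment_even:
  assumes "0 < \<sigma>"
  shows "has_bochner_integral lborel (\<lambda>y. folded_normal_density 0 \<sigma> y * (y / \<sigma>) ^ (2 * k))
    (fact (2 * k) / (2 ^ k * fact k))"
proof -
  have "has_bochner_integral lborel (\<lambda>y. normal_density 0 \<sigma> y * (y - 0) ^ (2 * k) * (1 / \<sigma> ^ (2 * k)))
      (fact (2 * k) / ((2 / \<sigma>\<^sup>2) ^ k * fact k) * (1 / \<sigma> ^ (2 * k)))"
    by (intro has_bochner_integral_mult_left normal_moment_even assms)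
  also have "fact (2 * k) / ((2 / \<sigma>\<^sup>2) ^ k * fact k) * (1 / \<sigma> ^ (2 * k)) = fact (2 * k) / (2 ^ k * fact k)"
  proof -
    have "(2 / \<sigma>\<^sup>2) ^ k = 2 ^ k / \<sigma> ^ (2 * k)"
      by (simp add: power_divide power_mult)
    then show ?thesis
      using assms by simp
  qed
  finally have "has_bochner_integral lborel (\<lambda>y. normal_density 0 \<sigma> y * (y / \<sigma>) ^ (2 * k))
      (fact (2 * k) / (2 ^ k * fact k))"
    by (simp add: power_divide)
  then have "has_bochner_integral lborel
      (\<lambda>y. indicator {0..} y * (normal_density 0 \<sigma> y * (y / \<sigma>) ^ (2 * k)))
      (fact (2 * k) / (2 ^ k * fact k) / 2)"
    by (rule has_bochner_integral_even_halfline) (simp add: normal_density_def)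
  from has_bochner_integral_mult_right[OF this, of 2] show ?thesis
    by (simp add: folded_normal_density_zero_mean[OF assms] mult_ac)
qed

section \<open>Weak law of large numbers and stability of limits under perturbation\<close>

lemma (in prob_space) second_moment_sum_indep:
  fixes V :: "nat \<Rightarrow> 'a \<Rightarrow> real"
  assumes indep: "indep_vars (\<lambda>_. borel) V UNIV"
    and mean: "\<And>i. expectation (V i) = 0"
    and sq: "\<And>i. integrable M (\<lambda>\<omega>. (V i \<omega>)\<^sup>2)"
  shows "integrable M (\<lambda>\<omega>. (\<Sum>i<n. V i \<omega>)\<^sup>2) \<and>
    expectation (\<lambda>\<omega>. (\<Sum>i<n. V i \<omega>)\<^sup>2) = (\<Sum>i<n. expectation (\<lambda>\<omega>. (V i \<omega>)\<^sup>2))"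
proof (induction n)
  case 0
  then show ?case by simp
next
  case (Suc n)
  have [measurable]: "V i \<in> borel_measurable M" for i
    using indep by (simp add: indep_vars_def2)
  have int: "integrable M (V i)" for i
    using square_integrable_imp_integrable[OF _ sq] by simp
  have ind: "indep_var borel (V n) borel (\<lambda>\<omega>. \<Sum>i<n. V i \<omega>)"
    by (rule indep_vars_sum) (auto intro: indep_vars_subset[OF indep])
  have intS: "integrable M (\<lambda>\<omega>. \<Sum>i<n. V i \<omega>)"
    using int by simp
  \<comment> \<open>The cross term in the square vanishes because the new centred variable is
    independent of the partial sum.\<close>
  have prod: "integrable M (\<lambda>\<omega>. V n \<omega> * (\<Sum>i<n. V i \<omega>))"
    "expectation (\<lambda>\<omega>. V n \<omega> * (\<Sum>i<n. V i \<omega>)) = 0"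
    using indep_var_integrable[OF ind int intS] indep_var_lebesgue_integral[OF ind int intS] mean
    by auto
  have "(\<lambda>\<omega>. (\<Sum>i<Suc n. V i \<omega>)\<^sup>2) =
      (\<lambda>\<omega>. (\<Sum>i<n. V i \<omega>)\<^sup>2 + (V n \<omega>)\<^sup>2 + 2 * (V n \<omega> * (\<Sum>i<n. V i \<omega>)))"
    by (auto simp: power2_eq_square algebra_simps)
  then show ?case
    using Suc prod sq by simp
qed

text \<open>Chebyshev's inequality for the centred mean, whose second moment is
  \<open>v / n\<close>.\<close>

lemma (in prob_space) weak_law_of_large_numbers:
  fixes X :: "nat \<Rightarrow> 'a \<Rightarrow> real"
  assumes indep: "indep_vars (\<lambda>_. borel) X UNIV"
    and mean: "\<And>i. expectation (X i) = m"
    and sq: "\<And>i. integrable M (\<lambda>\<omega>. (X i \<omega>)\<^sup>2)"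
    and var: "\<And>i. variance (X i) = v"
    and "0 < \<epsilon>"
  shows "(\<lambda>n. prob {\<omega> \<in> space M. \<epsilon> \<le> \<bar>(\<Sum>i<n. X i \<omega>) / n - m\<bar>}) \<longlonglongrightarrow> 0"
proof (rule tendsto_sandwich[where f = "\<lambda>_. 0" and h = "\<lambda>n. v / \<epsilon>\<^sup>2 * (1 / real n)"])
  have [measurable]: "X i \<in> borel_measurable M" for i
    using indep by (simp add: indep_vars_def2)
  have int: "integrable M (X i)" for i
    using square_integrable_imp_integrable[OF _ sq] by simp
  define V where "V i \<omega> = X i \<omega> - m" for i \<omega>
  have indepV: "indep_vars (\<lambda>_. borel) V UNIV"
    using indep_vars_compose2[OF indep, of "\<lambda>_ x. x - m" "\<lambda>_. borel"] by (simp add: V_def[abs_def])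
  have meanV: "expectation (V i) = 0" for i
    using int mean by (simp add: V_def[abs_def] prob_space)
  have sqV: "integrable M (\<lambda>\<omega>. (V i \<omega>)\<^sup>2)" for i
    using int sq by (simp add: V_def power2_diff)
  have varV: "expectation (\<lambda>\<omega>. (V i \<omega>)\<^sup>2) = v" for i
    using var mean by (simp add: V_def)
  show "eventually (\<lambda>n. prob {\<omega> \<in> space M. \<epsilon> \<le> \<bar>(\<Sum>i<n. X i \<omega>) / n - m\<bar>} \<le> v / \<epsilon>\<^sup>2 * (1 / real n)) sequentially"
    using eventually_gt_at_top[of 0]
  proof eventually_elim
    case (elim n)
    let ?f = "\<lambda>\<omega>. (\<Sum>i<n. V i \<omega>) / n"
    have f: "(\<Sum>i<n. X i \<omega>) / n - m = ?f \<omega>" for \<omega>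
      using elim by (simp add: V_def sum_subtractf field_simps)
    have "prob {\<omega> \<in> space M. \<epsilon> \<le> \<bar>?f \<omega>\<bar>} \<le> expectation (\<lambda>\<omega>. (?f \<omega>)\<^sup>2) / \<epsilon>\<^sup>2"
      using second_moment_sum_indep[OF indepV meanV sqV, of n] \<open>0 < \<epsilon>\<close>
      by (intro second_moment_method) (auto simp: power_divide V_def)
    also have "expectation (\<lambda>\<omega>. (?f \<omega>)\<^sup>2) = v / n"
      using second_moment_sum_indep[OF indepV meanV sqV, of n] elim
      by (simp add: power_divide varV) (simp add: power2_eq_square)
    finally show ?case by (simp add: f mult.commute)
  qed
  show "(\<lambda>n. v / \<epsilon>\<^sup>2 * (1 / real n)) \<longlonglongrightarrow> 0"
    by (intro tendsto_mult_right_zero lim_1_over_n)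
qed auto

text \<open>A form of Slutsky's theorem. The event \<open>E n\<close> is only squeezed between a
  strict and a weak inequality, which leaves ties undecided; continuity of the limiting distribution
  function makes them harmless.\<close>

lemma (in prob_space) prob_tendsto_cdf_of_perturbation:
  fixes A R :: "nat \<Rightarrow> 'a \<Rightarrow> real"
  assumes [measurable]: "\<And>n. A n \<in> borel_measurable M" "\<And>n. R n \<in> borel_measurable M" "\<And>n. E n \<in> events"
    and conv: "weak_conv_m (\<lambda>n. distr M borel (A n)) \<nu>"
    and cont: "\<And>x. isCont (cdf \<nu>) x"
    and R: "\<And>\<epsilon>. 0 < \<epsilon> \<Longrightarrow> (\<lambda>n. prob {\<omega> \<in> space M. \<epsilon> \<le> \<bar>R n \<omega>\<bar>}) \<longlonglongrightarrow> 0"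
    and lower: "\<And>n. 0 < n \<Longrightarrow> AE \<omega> in M. A n \<omega> + R n \<omega> < c \<longrightarrow> \<omega> \<in> E n"
    and upper: "\<And>n. 0 < n \<Longrightarrow> AE \<omega> in M. \<omega> \<in> E n \<longrightarrow> A n \<omega> + R n \<omega> \<le> c"
  shows "(\<lambda>n. prob (E n)) \<longlonglongrightarrow> cdf \<nu> c"
proof (rule tendstoI)
  fix e :: real assume e: "0 < e"
  have A: "(\<lambda>n. prob {\<omega> \<in> space M. A n \<omega> \<le> x}) \<longlonglongrightarrow> cdf \<nu> x" for x
  proof -
    have "cdf (distr M borel (A n)) x = prob {\<omega> \<in> space M. A n \<omega> \<le> x}" for n
      by (auto simp: cdf_def measure_distr intro!: arg_cong[where f = prob])
    moreover have "(\<lambda>n. cdf (distr M borel (A n)) x) \<longlonglongrightarrow> cdf \<nu> x"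
      using conv cont[of x] by (simp add: weak_conv_m_def weak_conv_def)
    ultimately show ?thesis by simp
  qed
  obtain d0 where d0: "0 < d0" "\<And>x. dist x c < d0 \<Longrightarrow> dist (cdf \<nu> x) (cdf \<nu> c) < e / 2"
    using cont[of c] e unfolding continuous_at_eps_delta dist_real_def
    by (metis half_gt_zero)
  define d where "d = d0 / 2"
  have d: "0 < d" "dist (cdf \<nu> (c + d)) (cdf \<nu> c) < e / 2" "dist (cdf \<nu> (c - d)) (cdf \<nu> c) < e / 2"
    using d0 by (auto simp: d_def dist_real_def)
  have "eventually (\<lambda>n. dist (prob {\<omega> \<in> space M. A n \<omega> \<le> c + d}) (cdf \<nu> (c + d)) < e / 4) sequentially"
    "eventually (\<lambda>n. dist (prob {\<omega> \<in> space M. A n \<omega> \<le> c - d}) (cdf \<nu> (c - d)) < e / 4) sequentially"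
    "eventually (\<lambda>n. dist (prob {\<omega> \<in> space M. d \<le> \<bar>R n \<omega>\<bar>}) 0 < e / 4) sequentially"
    using tendstoD[OF A, of "e / 4"] tendstoD[OF R[OF d(1)], of "e / 4"] e by auto
  then show "eventually (\<lambda>n. dist (prob (E n)) (cdf \<nu> c) < e) sequentially"
    using eventually_gt_at_top[of 0]
  proof eventually_elim
    case (elim n)
    \<comment> \<open>Where the modulus of \<open>R n\<close> is below \<open>d\<close>, the event
      \<open>E n\<close> forces \<open>A n \<omega> \<le> c + d\<close>, and conversely
      \<open>A n \<omega> \<le> c - d\<close> forces \<open>E n\<close>.\<close>
    have "prob (E n) \<le> prob ({\<omega> \<in> space M. A n \<omega> \<le> c + d} \<union> {\<omega> \<in> space M. d \<le> \<bar>R n \<omega>\<bar>})"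
      using upper[OF elim(4)] by (intro finite_measure_mono_AE) (auto elim!: eventually_mono)
    also have "\<dots> \<le> prob {\<omega> \<in> space M. A n \<omega> \<le> c + d} + prob {\<omega> \<in> space M. d \<le> \<bar>R n \<omega>\<bar>}"
      by (intro measure_Un_le) auto
    finally have 1: "prob (E n) \<le> \<dots>" .
    have "prob {\<omega> \<in> space M. A n \<omega> \<le> c - d} \<le> prob (E n \<union> {\<omega> \<in> space M. d \<le> \<bar>R n \<omega>\<bar>})"
      using lower[OF elim(4)] by (intro finite_measure_mono_AE) (auto elim!: eventually_mono)
    also have "\<dots> \<le> prob (E n) + prob {\<omega> \<in> space M. d \<le> \<bar>R n \<omega>\<bar>}"
      by (intro measure_Un_le) auto
    finally have 2: "prob {\<omega> \<in> space M. A n \<omega> \<le> c - d} \<le> \<dots>" .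
    have "prob {\<omega> \<in> space M. A n \<omega> \<le> c + d} - cdf \<nu> (c + d) < e / 4"
      "- (e / 4) < prob {\<omega> \<in> space M. A n \<omega> \<le> c - d} - cdf \<nu> (c - d)"
      "prob {\<omega> \<in> space M. d \<le> \<bar>R n \<omega>\<bar>} < e / 4"
      "cdf \<nu> (c + d) - cdf \<nu> c < e / 2" "- (e / 2) < cdf \<nu> (c - d) - cdf \<nu> c"
      using elim(1-3) d(2,3) unfolding dist_real_def by linarith+
    with 1 2 have "prob (E n) - cdf \<nu> c < e" "- e < prob (E n) - cdf \<nu> c"
      by linarith+
    then show ?case
      by (simp add: dist_real_def abs_less_iff)
  qed
qed

section \<open>Limit law of the score at distance of order \<open>n powr (- 1 / 4)\<close> from
  0\<close>

lemma isCont_cdf_std_normal: "isCont (cdf std_normal_distribution) x"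
proof -
  interpret real_distribution std_normal_distribution
    by (rule real_dist_normal_dist)
  have "emeasure std_normal_distribution {x} = 0"
    by (simp add: emeasure_density nn_integral_null_set[of "{x}" lborel])
  then show ?thesis
    by (simp add: isCont_cdf measure_def)
qed

text \<open>The score is divided by \<open>sqrt (2 * n)\<close>. The fourth moment 3 cancels the 3
  in the cubic coefficient, and the squared scale is \<open>a\<^sup>2 / sqrt n\<close>, so the drift
  is \<open>- a\<^sup>2 / sqrt 2\<close>. Fluctuations come from the sum of squares.\<close>

lemma (in prob_space) score_ratio_limit:
  fixes X :: "nat \<Rightarrow> 'a \<Rightarrow> real"
  assumes indep: "indep_vars (\<lambda>_. borel) X UNIV"
    and moment_int: "\<And>i k. integrable M (\<lambda>\<omega>. X i \<omega> ^ (2 * k))"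
    and moment: "\<And>i k. expectation (\<lambda>\<omega>. X i \<omega> ^ (2 * k)) = fact (2 * k) / (2 ^ k * fact k)"
    and distr_X: "\<And>i. distr M borel (X i) = \<mu>"
    and nonneg: "\<And>i. AE \<omega> in M. 0 \<le> X i \<omega>"
    and a: "0 < a"
    and E[measurable]: "\<And>n. E n \<in> events"
    and lower: "\<And>n. 0 < n \<Longrightarrow> AE \<omega> in M. score_ratio (\<lambda>i. X i \<omega>) n (a * n powr (- 1 / 4)) < 0 \<longrightarrow> \<omega> \<in> E n"
    and upper: "\<And>n. 0 < n \<Longrightarrow> AE \<omega> in M. \<omega> \<in> E n \<longrightarrow> score_ratio (\<lambda>i. X i \<omega>) n (a * n powr (- 1 / 4)) \<le> 0"
  shows "(\<lambda>n. prob (E n)) \<longlonglongrightarrow> cdf std_normal_distribution (a\<^sup>2 / sqrt 2)"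
proof -
  have [measurable]: "X i \<in> borel_measurable M" for i
    using indep by (simp add: indep_vars_def2)
  have [measurable]: "(tanh :: real \<Rightarrow> real) \<in> borel_measurable borel"
    by (intro borel_measurable_continuous_onI continuous_intros) auto
  define T where "T n \<omega> = score_ratio (\<lambda>i. X i \<omega>) n (a * n powr (- 1 / 4))" for n \<omega>
  \<comment> \<open>The variance of a squared observation is 3 - 1 = 2, written as
    \<open>(sqrt 2)\<^sup>2\<close> to fit the central limit theorem.\<close>
  define A where "A n \<omega> = (\<Sum>i<n. (X i \<omega>)\<^sup>2 - 1) / sqrt (n * (sqrt 2)\<^sup>2)" for n \<omega>
  define R where "R n \<omega> = T n \<omega> / sqrt (2 * n) - A n \<omega> + a\<^sup>2 / sqrt 2" for n \<omega>
  have [measurable]: "T n \<in> borel_measurable M" "A n \<in> borel_measurable M" "R n \<in> borel_measurable M" for n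
    unfolding T_def[abs_def] A_def[abs_def] R_def[abs_def] score_ratio_def by measurable
  have m2: "expectation (\<lambda>\<omega>. (X i \<omega>)\<^sup>2) = 1" for i
    using moment[of i 1] by simp
  have m4: "expectation (\<lambda>\<omega>. X i \<omega> ^ 4) = 3" for i
    using moment[of i 2] by (simp add: fact_numeral)
  have m6: "expectation (\<lambda>\<omega>. X i \<omega> ^ 6) = 15" for i
    using moment[of i 3] by (simp add: fact_numeral)
  have i2: "integrable M (\<lambda>\<omega>. (X i \<omega>)\<^sup>2)" "integrable M (\<lambda>\<omega>. X i \<omega> ^ 4)" "integrable M (\<lambda>\<omega>. X i \<omega> ^ 6)" for i
    using moment_int[of i 1] moment_int[of i 2] moment_int[of i 3] by auto
  have indep_pow: "indep_vars (\<lambda>_. borel) (\<lambda>i \<omega>. X i \<omega> ^ k) UNIV" for k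
    using indep_vars_compose2[OF indep, of "\<lambda>_ x. x ^ k" "\<lambda>_. borel"] by simp
  have clt: "weak_conv_m (\<lambda>n. distr M borel (A n)) std_normal_distribution"
    unfolding A_def
  proof (rule central_limit_theorem[OF indep_pow m2, where \<mu> = "distr \<mu> borel (\<lambda>x. x\<^sup>2)"])
    show "integrable M (\<lambda>\<omega>. ((X i \<omega>)\<^sup>2)\<^sup>2)" for i
      using i2(2) by (simp flip: power_mult)
    then show "variance (\<lambda>\<omega>. (X i \<omega>)\<^sup>2) = (sqrt 2)\<^sup>2" for i
      using i2 m2 m4 by (subst variance_eq) (auto simp flip: power_mult)
    show "distr M borel (\<lambda>\<omega>. (X i \<omega>)\<^sup>2) = distr \<mu> borel (\<lambda>x. x\<^sup>2)" for i
      unfolding distr_X[of i, symmetric] by (subst distr_distr) (auto simp: comp_def)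
  qed simp
  have lln: "(\<lambda>n. prob {\<omega> \<in> space M. \<epsilon> \<le> \<bar>(\<Sum>i<n. X i \<omega> ^ (2 * k)) / n - fact (2 * k) / (2 ^ k * fact k)\<bar>}) \<longlonglongrightarrow> 0"
    if "0 < \<epsilon>" for \<epsilon> k
  proof (rule weak_law_of_large_numbers[OF indep_pow moment _ _ that])
    \<comment> \<open>The square is the power of order \<open>4 * k\<close>, again even, so the
      moment hypotheses also supply the variance.\<close>
    show sq: "integrable M (\<lambda>\<omega>. (X i \<omega> ^ (2 * k))\<^sup>2)" for i
      using moment_int[of i "2 * k"] by (simp add: mult_ac flip: power_mult)
    show "variance (\<lambda>\<omega>. X i \<omega> ^ (2 * k)) =
        fact (2 * (2 * k)) / (2 ^ (2 * k) * fact (2 * k)) - (fact (2 * k) / (2 ^ k * fact k))\<^sup>2" for i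
    proof -
      have "expectation (\<lambda>\<omega>. (X i \<omega> ^ (2 * k))\<^sup>2) = fact (2 * (2 * k)) / (2 ^ (2 * k) * fact (2 * k))"
        using moment[of i "2 * k"] by (simp add: mult_ac flip: power_mult)
      then show ?thesis
        by (subst variance_eq[OF moment_int sq]) (simp only: moment)
    qed
  qed
  \<comment> \<open>The first term is the error of replacing the empirical fourth moment by 3, the
    second the Taylor remainder. A factor \<open>1 / sqrt 2\<close> is bounded by 1.\<close>
  have R_bound: "\<bar>R n \<omega>\<bar> \<le> a\<^sup>2 / 3 * \<bar>(\<Sum>i<n. X i \<omega> ^ 4) / n - 3\<bar> + a ^ 4 / sqrt n * ((\<Sum>i<n. X i \<omega> ^ 6) / n)"
    if n: "0 < n" and X: "\<And>i. 0 \<le> X i \<omega>" for n \<omega>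
  proof -
    define s where "s = a * n powr (- 1 / 4)"
    have s: "0 < s" using a n by (simp add: s_def)
    have s2: "s\<^sup>2 = a\<^sup>2 / sqrt n"
    proof -
      have "(real n powr (- 1 / 4))\<^sup>2 = real n powr (- (1 / 2))"
        by (simp add: power2_eq_square flip: powr_add)
      also have "\<dots> = 1 / sqrt n"
        by (simp only: powr_minus_divide powr_half_sqrt of_nat_0_le_iff)
      finally show ?thesis by (simp only: s_def power_mult_distrib) simp
    qed
    have s4: "s ^ 4 = a ^ 4 / n"
      using n s2 power_mult[of s 2 2] power_mult[of a 2 2] by (simp add: power_divide)
    define D where "D = T n \<omega> - (\<Sum>i<n. (X i \<omega>)\<^sup>2 - 1)"
    define S4 where "S4 = (\<Sum>i<n. X i \<omega> ^ 4)"
    define S6 where "S6 = (\<Sum>i<n. X i \<omega> ^ 6)"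
    have "\<bar>D + s\<^sup>2 / 3 * S4\<bar> \<le> s ^ 4 * S6"
      using score_ratio_expansion[of n "\<lambda>i. X i \<omega>", OF X s]
      by (simp add: D_def T_def s_def S4_def S6_def)
    then have D: "\<bar>D + s\<^sup>2 / 3 * S4\<bar> / sqrt n \<le> s ^ 4 * S6 / sqrt n"
      by (intro divide_right_mono) auto
    have "D / sqrt n + a\<^sup>2 / 3 * (S4 / n) = (D + s\<^sup>2 / 3 * S4) / sqrt n"
      unfolding s2 by (simp add: add_divide_distrib)
    then have 1: "\<bar>D / sqrt n + a\<^sup>2 / 3 * (S4 / n)\<bar> \<le> a ^ 4 / sqrt n * (S6 / n)"
      using D unfolding s4 by (simp add: abs_divide mult_ac)
    have "1 * \<bar>R n \<omega>\<bar> \<le> sqrt 2 * \<bar>R n \<omega>\<bar>"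
      by (rule mult_right_mono) auto
    then have "\<bar>R n \<omega>\<bar> \<le> \<bar>sqrt 2 * R n \<omega>\<bar>"
      by (simp add: abs_mult)
    also have "sqrt 2 * R n \<omega> = D / sqrt n + a\<^sup>2"
    proof -
      have "R n \<omega> = (D / sqrt n + a\<^sup>2) / sqrt 2"
        by (simp add: R_def A_def D_def real_sqrt_mult diff_divide_distrib add_divide_distrib mult.commute)
      then show ?thesis by simp
    qed
    also have "\<bar>\<dots>\<bar> \<le> a\<^sup>2 / 3 * \<bar>S4 / n - 3\<bar> + a ^ 4 / sqrt n * (S6 / n)"
    proof -
      have "D / sqrt n + a\<^sup>2 = (D / sqrt n + a\<^sup>2 / 3 * (S4 / n)) - a\<^sup>2 / 3 * (S4 / n - 3)"
        by (simp add: right_diff_distrib)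
      also have "\<bar>\<dots>\<bar> \<le> \<bar>D / sqrt n + a\<^sup>2 / 3 * (S4 / n)\<bar> + \<bar>a\<^sup>2 / 3 * (S4 / n - 3)\<bar>"
        by (rule abs_triangle_ineq4)
      finally show ?thesis using 1 by (simp add: abs_mult)
    qed
    finally show ?thesis by (simp add: S4_def S6_def)
  qed
  have nonneg': "AE \<omega> in M. \<forall>i. 0 \<le> X i \<omega>"
    using nonneg by (simp add: AE_all_countable)
  have R_lim: "(\<lambda>n. prob {\<omega> \<in> space M. \<epsilon> \<le> \<bar>R n \<omega>\<bar>}) \<longlonglongrightarrow> 0" if \<epsilon>: "0 < \<epsilon>" for \<epsilon>
  proof -
    \<comment> \<open>The threshold is chosen so that \<open>a\<^sup>2 / 3\<close> times it equals
      \<open>\<epsilon> / 2\<close>. Off \<open>?B6 n\<close> the empirical sixth moment is below 15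
      + 1 = 16, and the remainder is eventually below \<open>\<epsilon> / 2\<close> too.\<close>
    let ?B4 = "\<lambda>n. {\<omega> \<in> space M. 3 * \<epsilon> / (2 * a\<^sup>2) \<le> \<bar>(\<Sum>i<n. X i \<omega> ^ 4) / n - 3\<bar>}"
    let ?B6 = "\<lambda>n. {\<omega> \<in> space M. 1 \<le> \<bar>(\<Sum>i<n. X i \<omega> ^ 6) / n - 15\<bar>}"
    have lim: "(\<lambda>n. prob (?B4 n) + prob (?B6 n)) \<longlonglongrightarrow> 0"
      using tendsto_add[OF lln[of "3 * \<epsilon> / (2 * a\<^sup>2)" 2] lln[of 1 3]] \<epsilon> a by (simp add: fact_numeral)
    have "(\<lambda>n. a ^ 4 / sqrt (real n) * 16) \<longlonglongrightarrow> 0"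
      by real_asymp
    then have "eventually (\<lambda>n. a ^ 4 / sqrt (real n) * 16 < \<epsilon> / 2) sequentially"
      using \<epsilon> by (auto dest: order_tendstoD(2)[of _ _ _ "\<epsilon> / 2"])
    then have le: "eventually (\<lambda>n. prob {\<omega> \<in> space M. \<epsilon> \<le> \<bar>R n \<omega>\<bar>} \<le> prob (?B4 n) + prob (?B6 n)) sequentially"
      using eventually_gt_at_top[of 0]
    proof eventually_elim
      case (elim n)
      have sub: "\<omega> \<in> ?B4 n \<union> ?B6 n" if "\<omega> \<in> space M" "\<And>i. 0 \<le> X i \<omega>" "\<epsilon> \<le> \<bar>R n \<omega>\<bar>" for \<omega>
      proof (rule ccontr)
        assume "\<omega> \<notin> ?B4 n \<union> ?B6 n"
        with that have *: "\<bar>(\<Sum>i<n. X i \<omega> ^ 4) / n - 3\<bar> < 3 * \<epsilon> / (2 * a\<^sup>2)"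
          "(\<Sum>i<n. X i \<omega> ^ 6) / n < 16"
          by (auto simp: not_le abs_less_iff)
        have "a\<^sup>2 / 3 * \<bar>(\<Sum>i<n. X i \<omega> ^ 4) / n - 3\<bar> \<le> a\<^sup>2 / 3 * (3 * \<epsilon> / (2 * a\<^sup>2))"
          using *(1) by (intro mult_left_mono) auto
        also have "\<dots> = \<epsilon> / 2" using a by simp
        finally have "a\<^sup>2 / 3 * \<bar>(\<Sum>i<n. X i \<omega> ^ 4) / n - 3\<bar> \<le> \<epsilon> / 2" .
        moreover have "a ^ 4 / sqrt n * ((\<Sum>i<n. X i \<omega> ^ 6) / n) \<le> a ^ 4 / sqrt n * 16"
          using *(2) a by (intro mult_left_mono) auto
        ultimately show False
          using R_bound[OF elim(2) that(2)] that(3) elim(1) by linarith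
      qed
      have "prob {\<omega> \<in> space M. \<epsilon> \<le> \<bar>R n \<omega>\<bar>} \<le> prob (?B4 n \<union> ?B6 n)"
      proof (rule finite_measure_mono_AE)
        show "AE \<omega> in M. \<omega> \<in> {\<omega> \<in> space M. \<epsilon> \<le> \<bar>R n \<omega>\<bar>} \<longrightarrow> \<omega> \<in> ?B4 n \<union> ?B6 n"
          using nonneg' by eventually_elim (use sub in blast)
      qed measurable
      also have "\<dots> \<le> prob (?B4 n) + prob (?B6 n)"
        by (intro measure_Un_le) auto
      finally show ?case .
    qed
    show ?thesis
      by (rule tendsto_sandwich[OF _ le tendsto_const lim]) auto
  qed
  \<comment> \<open>For positive \<open>n\<close>, comparing this sum with
    \<open>a\<^sup>2 / sqrt 2\<close> is the same as reading off the sign of the score.\<close>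
  have sgn: "A n \<omega> + R n \<omega> = T n \<omega> / sqrt (2 * n) + a\<^sup>2 / sqrt 2" for n \<omega>
    by (simp add: R_def)
  show ?thesis
  proof (rule prob_tendsto_cdf_of_perturbation[OF _ _ E clt isCont_cdf_std_normal R_lim])
    fix n :: nat assume n: "0 < n"
    show "AE \<omega> in M. A n \<omega> + R n \<omega> < a\<^sup>2 / sqrt 2 \<longrightarrow> \<omega> \<in> E n"
      using lower[OF n] n by (auto simp: sgn T_def divide_less_0_iff elim!: eventually_mono)
    show "AE \<omega> in M. \<omega> \<in> E n \<longrightarrow> A n \<omega> + R n \<omega> \<le> a\<^sup>2 / sqrt 2"
      using upper[OF n] n by (auto simp: sgn T_def divide_le_0_iff elim!: eventually_mono)
  qed auto
qed

section \<open>Mass of the atom and limit law of the maximizer\<close>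

lemma (in prob_space) prob_normal_nonpos:
  assumes "distributed M lborel X (\<lambda>x. ennreal (normal_density 0 \<sigma> x))" "0 < \<sigma>"
  shows "prob {\<omega> \<in> space M. X \<omega> \<le> 0} = 1 / 2"
proof -
  \<comment> \<open>By symmetry the event is that a variable of the same law is nonnegative, and its
    probability is half the integral of the even density.\<close>
  have D: "distributed M lborel (\<lambda>\<omega>. - X \<omega>) (\<lambda>x. ennreal (normal_density 0 \<sigma> x))"
    using normal_density_affine[OF assms, of "- 1" 0] by simp
  have [measurable]: "X \<in> borel_measurable M"
    using distributed_measurable[OF assms(1)] by simp
  have "has_bochner_integral lborel (normal_density 0 \<sigma>) 1"
    using assms(2) by (simp add: has_bochner_integral_iff)
  then have "has_bochner_integral lborel (\<lambda>x. indicator {0..} x * normal_density 0 \<sigma> x) (1 / 2)"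
    by (rule has_bochner_integral_even_halfline) (simp add: normal_density_def)
  then have "1 / 2 = (\<integral>x. normal_density 0 \<sigma> x * indicator {0..} x \<partial>lborel)"
    by (simp add: has_bochner_integral_iff mult.commute)
  also have "\<dots> = expectation (\<lambda>\<omega>. indicator {0..} (- X \<omega>))"
    by (rule distributed_integral[OF D]) auto
  also have "\<dots> = expectation (indicator {\<omega> \<in> space M. X \<omega> \<le> 0})"
    by (intro Bochner_Integration.integral_cong) (auto simp: indicator_def)
  finally show ?thesis by simp
qed

theorem theoremD7:
  fixes M :: "'a measure" and N :: "'b measure"
    and Y :: "nat \<Rightarrow> 'a \<Rightarrow> real" and \<mu>hat :: "nat \<Rightarrow> 'a \<Rightarrow> real"
    and W Z :: "'b \<Rightarrow> real" and \<sigma>\<^sub>0 :: real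
  assumes "prob_space M"
    and "\<sigma>\<^sub>0 > 0"
    and "prob_space.indep_vars M (\<lambda>_. borel) Y UNIV"
    and "\<And>i. distributed M lborel (Y i) (\<lambda>y. ennreal (folded_normal_density 0 \<sigma>\<^sub>0 y))"
    and "\<And>n. \<mu>hat n \<in> borel_measurable M"
    and "\<And>n. AE \<omega> in M.
           is_arg_max (\<lambda>\<mu>. folded_normal_loglik (\<lambda>i. Y i \<omega>) n \<mu> \<sigma>\<^sub>0) (\<lambda>\<mu>. \<mu> \<in> UNIV) (\<mu>hat n \<omega>)"
    and "prob_space N"
    and "distributed N lborel W (\<lambda>x. ennreal (std_normal_density x))"
    and "Z = (\<lambda>\<omega>. sqrt 2 * \<sigma>\<^sub>0\<^sup>2 * W \<omega>)"
  shows "distributed N lborel Z (\<lambda>x. ennreal (normal_density 0 (sqrt (2 * \<sigma>\<^sub>0 ^ 4)) x)) \<and>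
         weak_conv_m (\<lambda>n. distr M borel (\<lambda>\<omega>. real n powr (1 / 4) * \<bar>\<mu>hat n \<omega>\<bar>))
           (distr N borel (\<lambda>\<omega>. sqrt (max (Z \<omega>) 0))) \<and>
         (\<forall>\<omega>\<in>space N. sqrt (max (Z \<omega>) 0) = 2 powr (1 / 4) * \<sigma>\<^sub>0 * sqrt (max (W \<omega>) 0)) \<and>
         measure (distr N borel (\<lambda>\<omega>. sqrt (max (Z \<omega>) 0))) {0} = 1 / 2 \<and>
         (\<forall>\<omega>\<in>space N. W \<omega> > 0 \<longrightarrow> sqrt (max (Z \<omega>) 0) = 2 powr (1 / 4) * \<sigma>\<^sub>0 * sqrt (W \<omega>))"
proof -
  interpret M: prob_space M by fact
  interpret N: prob_space N by fact
  note \<sigma> = \<open>\<sigma>\<^sub>0 > 0\<close> and Z = \<open>Z = _\<close>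
  note \<mu>hat[measurable] = assms(5)
  note dW = assms(8)
  have Ym[measurable]: "Y i \<in> borel_measurable M" for i
    using distributed_measurable[OF assms(4)] by simp
  have Wm[measurable]: "W \<in> borel_measurable N"
    using distributed_measurable[OF dW] by simp
  have Zm[measurable]: "Z \<in> borel_measurable N"
    unfolding Z by measurable
  have Z_pos_iff: "Z \<omega> \<le> 0 \<longleftrightarrow> W \<omega> \<le> 0" for \<omega>
    using \<sigma> by (simp add: Z mult_le_0_iff)

  have distr_Z: "distributed N lborel Z (\<lambda>x. ennreal (normal_density 0 (sqrt (2 * \<sigma>\<^sub>0 ^ 4)) x))"
  proof -
    have "sqrt 2 * \<sigma>\<^sub>0\<^sup>2 = sqrt (2 * \<sigma>\<^sub>0 ^ 4)"
      by (rule real_sqrt_unique[symmetric]) (simp_all add: power_mult_distrib flip: power_mult)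
    then show ?thesis
      using N.normal_density_affine[OF dW, of "sqrt 2 * \<sigma>\<^sub>0\<^sup>2" 0] \<sigma> by (simp add: Z abs_mult)
  qed

  have sqrt_Z: "sqrt (max (Z \<omega>) 0) = 2 powr (1 / 4) * \<sigma>\<^sub>0 * sqrt (max (W \<omega>) 0)" for \<omega>
  proof -
    have "max (Z \<omega>) 0 = sqrt 2 * \<sigma>\<^sub>0\<^sup>2 * max (W \<omega>) 0"
      using Z_pos_iff[of \<omega>] by (auto simp: Z max_def)
    moreover have "sqrt (sqrt 2) = 2 powr (1 / 4)"
      by (simp add: powr_powr flip: powr_half_sqrt)
    ultimately show ?thesis
      using \<sigma> by (simp add: real_sqrt_mult)
  qed

  define L where "L = distr N borel (\<lambda>\<omega>. sqrt (max (Z \<omega>) 0))"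
  interpret L: real_distribution L
    unfolding L_def real_distribution_def real_distribution_axioms_def
    by (auto intro!: N.prob_space_distr)

  have atom: "measure L {0} = 1 / 2"
  proof -
    have "measure L {0} = N.prob {\<omega> \<in> space N. W \<omega> \<le> 0}"
    proof -
      have "sqrt (max (Z \<omega>) 0) = 0 \<longleftrightarrow> Z \<omega> \<le> 0" for \<omega>
        by (simp add: max_def)
      then have "(\<lambda>\<omega>. sqrt (max (Z \<omega>) 0)) -` {0} \<inter> space N = {\<omega> \<in> space N. W \<omega> \<le> 0}"
        unfolding Z_pos_iff by blast
      then show ?thesis
        by (simp add: L_def measure_distr)
    qed
    then show ?thesis
      using N.prob_normal_nonpos[OF dW] by simp
  qed

  have cdf_L_neg: "cdf L b = 0" if "b < 0" for b
  proof -
    have "(\<lambda>\<omega>. sqrt (max (Z \<omega>) 0)) -` {..b} \<inter> space N = {}"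
    proof -
      have "b < sqrt (max (Z \<omega>) 0)" for \<omega>
        by (rule less_le_trans[OF that]) simp
      then show ?thesis by (auto simp: not_le[symmetric])
    qed
    then show ?thesis
      by (simp add: cdf_def L_def measure_distr)
  qed
  \<comment> \<open>The right-hand side is the limit in \<open>score_ratio_limit\<close> at
    \<open>a = b / \<sigma>\<^sub>0\<close>.\<close>
  have cdf_L_pos: "cdf L b = cdf std_normal_distribution ((b / \<sigma>\<^sub>0)\<^sup>2 / sqrt 2)" if "0 < b" for b
  proof -
    have "sqrt (max (Z \<omega>) 0) \<le> b \<longleftrightarrow> W \<omega> \<le> (b / \<sigma>\<^sub>0)\<^sup>2 / sqrt 2" for \<omega>
    proof -
      have "sqrt (max (Z \<omega>) 0) \<le> b \<longleftrightarrow> max (Z \<omega>) 0 \<le> b\<^sup>2"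
        using real_sqrt_le_iff[of "max (Z \<omega>) 0" "b\<^sup>2"] that by simp
      also have "\<dots> \<longleftrightarrow> W \<omega> \<le> (b / \<sigma>\<^sub>0)\<^sup>2 / sqrt 2"
        using \<sigma> by (simp add: Z power_divide field_simps)
      finally show ?thesis .
    qed
    then have "cdf L b = measure (distr N lborel W) {..(b / \<sigma>\<^sub>0)\<^sup>2 / sqrt 2}"
      by (auto simp: cdf_def L_def measure_distr intro!: arg_cong[where f = N.prob])
    also have "\<dots> = cdf std_normal_distribution ((b / \<sigma>\<^sub>0)\<^sup>2 / sqrt 2)"
      by (simp add: cdf_def distributed_distr_eq_density[OF dW])
    finally show ?thesis .
  qed

  define X where "X i \<omega> = Y i \<omega> / \<sigma>\<^sub>0" for i \<omega>
  have [measurable]: "X i \<in> borel_measurable M" for i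
    unfolding X_def[abs_def] by measurable
  have fnd_nonneg: "0 \<le> folded_normal_density 0 \<sigma>\<^sub>0 y" for y
    using \<sigma> by (simp add: folded_normal_density_def)
  have indep_X: "M.indep_vars (\<lambda>_. borel) X UNIV"
    using M.indep_vars_compose2[OF assms(3), of "\<lambda>_ y. y / \<sigma>\<^sub>0" "\<lambda>_. borel"] by (simp add: X_def[abs_def])
  have moment_int: "integrable M (\<lambda>\<omega>. X i \<omega> ^ (2 * k))" for i k
    using distributed_integrable[OF assms(4), of "\<lambda>y. (y / \<sigma>\<^sub>0) ^ (2 * k)" i] fnd_nonneg
      folded_normal_moment_even[OF \<sigma>, of k]
    by (simp add: X_def has_bochner_integral_iff)
  have moment: "M.expectation (\<lambda>\<omega>. X i \<omega> ^ (2 * k)) = fact (2 * k) / (2 ^ k * fact k)" for i k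
    using distributed_integral[OF assms(4), of "\<lambda>y. (y / \<sigma>\<^sub>0) ^ (2 * k)" i] fnd_nonneg
      folded_normal_moment_even[OF \<sigma>, of k]
    by (simp add: X_def has_bochner_integral_iff)
  have distr_X: "distr M borel (X i) =
      distr (density lborel (\<lambda>y. ennreal (folded_normal_density 0 \<sigma>\<^sub>0 y))) borel (\<lambda>y. y / \<sigma>\<^sub>0)" for i
    unfolding distributed_distr_eq_density[OF assms(4), of i, symmetric]
    by (subst distr_distr) (auto simp: comp_def X_def[abs_def])
  have "AE \<omega> in M. 0 \<le> Y i \<omega>" for i
  proof -
    have "AE y in density lborel (\<lambda>y. ennreal (folded_normal_density 0 \<sigma>\<^sub>0 y)). 0 \<le> y"
      using distributed_borel_measurable[OF assms(4)]
      by (subst AE_density) (auto simp: folded_normal_density_def)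
    then have "AE y in distr M lborel (Y i). 0 \<le> y"
      unfolding distributed_distr_eq_density[OF assms(4)] .
    then show ?thesis
      by (subst (asm) AE_distr_iff) auto
  qed
  then have X_nonneg: "AE \<omega> in M. 0 \<le> X i \<omega>" for i
    using \<sigma> by (simp add: X_def zero_le_divide_iff)
  have argmax: "AE \<omega> in M. (\<forall>i. 0 \<le> X i \<omega>) \<and>
      (\<forall>t. ln_cosh_loglik (\<lambda>i. X i \<omega>) n t \<le> ln_cosh_loglik (\<lambda>i. X i \<omega>) n (\<mu>hat n \<omega> / \<sigma>\<^sub>0))" for n
  proof -
    have "AE \<omega> in M. \<forall>i. 0 \<le> X i \<omega>"
      using X_nonneg by (simp add: AE_all_countable)
    with assms(6)[of n] show ?thesis
    proof eventually_elim
      case (elim \<omega>)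
      then have Y: "0 \<le> Y i \<omega>" for i
        using \<sigma> by (simp add: X_def zero_le_divide_iff)
      \<comment> \<open>With the competitor written as \<open>t * \<sigma>\<^sub>0\<close>, the
        rescaled parameter is \<open>t\<close>; the part of the log-likelihood free of
        \<open>\<mu>\<close> then cancels.\<close>
      have "folded_normal_loglik (\<lambda>i. Y i \<omega>) n (t * \<sigma>\<^sub>0) \<sigma>\<^sub>0 \<le>
          folded_normal_loglik (\<lambda>i. Y i \<omega>) n (\<mu>hat n \<omega>) \<sigma>\<^sub>0" for t
        using elim(1) by (auto simp: is_arg_max_def not_less)
      then show ?case
        using elim(2) \<sigma> by (simp add: folded_normal_loglik_eq Y X_def)
    qed
  qed

  have cdf_pos: "(\<lambda>n. M.prob {\<omega> \<in> space M. n powr (1 / 4) * \<bar>\<mu>hat n \<omega>\<bar> \<le> b})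
      \<longlonglongrightarrow> cdf std_normal_distribution ((b / \<sigma>\<^sub>0)\<^sup>2 / sqrt 2)" if b: "0 < b" for b
  proof (rule M.score_ratio_limit[OF indep_X moment_int moment distr_X X_nonneg])
    show "0 < b / \<sigma>\<^sub>0" using b \<sigma> by simp
    fix n :: nat assume n: "0 < n"
    let ?s = "b / \<sigma>\<^sub>0 * n powr (- 1 / 4)"
    have s: "0 < ?s" using b \<sigma> n by simp
    \<comment> \<open>In this form the event concerns the modulus of the rescaled maximizer, and the
      sign of the score at \<open>?s\<close> decides it up to ties.\<close>
    have iff: "n powr (1 / 4) * \<bar>\<mu>hat n \<omega>\<bar> \<le> b \<longleftrightarrow> \<bar>\<mu>hat n \<omega> / \<sigma>\<^sub>0\<bar> \<le> ?s" for \<omega>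
      using n \<sigma> by (simp add: powr_minus field_simps flip: minus_divide_left)
    show "AE \<omega> in M. score_ratio (\<lambda>i. X i \<omega>) n ?s < 0 \<longrightarrow>
        \<omega> \<in> {\<omega> \<in> space M. n powr (1 / 4) * \<bar>\<mu>hat n \<omega>\<bar> \<le> b}"
      using argmax[of n] AE_space
    proof eventually_elim
      case (elim \<omega>)
      then show ?case
        using argmax_le_of_score_neg[of n "\<lambda>i. X i \<omega>", OF _ s] by (auto simp: iff simp del: abs_divide)
    qed
    show "AE \<omega> in M. \<omega> \<in> {\<omega> \<in> space M. n powr (1 / 4) * \<bar>\<mu>hat n \<omega>\<bar> \<le> b} \<longrightarrow>
        score_ratio (\<lambda>i. X i \<omega>) n ?s \<le> 0"
      using argmax[of n]
    proof eventually_elim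
      case (elim \<omega>)
      then show ?case
        using score_nonpos_of_argmax_le[of n "\<lambda>i. X i \<omega>", OF _ s] by (auto simp: iff simp del: abs_divide)
    qed
  qed measurable

  have "weak_conv_m (\<lambda>n. distr M borel (\<lambda>\<omega>. real n powr (1 / 4) * \<bar>\<mu>hat n \<omega>\<bar>)) L"
    unfolding weak_conv_m_def weak_conv_def
  proof (intro allI impI)
    fix b assume "isCont (cdf L) b"
    \<comment> \<open>The atom of the limit law exempts the threshold \<open>0\<close>, where no convergence is claimed.\<close>
    then have "b \<noteq> 0"
      using atom by (auto simp: L.isCont_cdf)
    have cdf: "cdf (distr M borel (\<lambda>\<omega>. real n powr (1 / 4) * \<bar>\<mu>hat n \<omega>\<bar>)) b =
        M.prob {\<omega> \<in> space M. n powr (1 / 4) * \<bar>\<mu>hat n \<omega>\<bar> \<le> b}" for n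
      by (auto simp: cdf_def measure_distr intro!: arg_cong[where f = M.prob])
    show "(\<lambda>n. cdf (distr M borel (\<lambda>\<omega>. real n powr (1 / 4) * \<bar>\<mu>hat n \<omega>\<bar>)) b) \<longlonglongrightarrow> cdf L b"
    proof (cases "0 < b")
      case True
      then show ?thesis
        using cdf_pos[of b] by (simp add: cdf cdf_L_pos)
    next
      case False
      with \<open>b \<noteq> 0\<close> have b: "b < 0" by simp
      have "{\<omega> \<in> space M. n powr (1 / 4) * \<bar>\<mu>hat n \<omega>\<bar> \<le> b} = {}" for n :: nat
        using b by (auto simp: not_le intro: less_le_trans)
      then show ?thesis
        unfolding cdf cdf_L_neg[OF b] by (simp only: measure_empty tendsto_const)
    qed
  qed
  then show ?thesis
    using distr_Z sqrt_Z atom by (auto simp: L_def)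
qed

end
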